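(* Let $\{\mathsf{P}_\theta : \theta \in \mathbb{T}\}$ be a statistical model for data $Z$ taking values in a sample space $\mathbb{Z}$, where each $\mathsf{P}_\theta$ has a density/mass function $p_\theta$ with respect to a common dominating measure, and assume that $\sup_{\vartheta \in \mathbb{T}} p_\vartheta(z)$ is finite for almost all $z$. Let $$R(z,\theta) = \frac{p_\theta(z)}{\sup_{\vartheta \in \mathbb{T}} p_\vartheta(z)}, \qquad \pi_z(\theta) = \mathsf{P}_\theta\bigl\{ R(Z,\theta) \leq R(z,\theta) \bigr\}, \qquad \theta \in \mathbb{T},\ z \in \mathbb{Z}.$$ For $\alpha \in [0,1]$, let $$C_\alpha(z) = \{\theta \in \mathbb{T} : \pi_z(\theta) \geq \alpha\}$$ be the upper $\alpha$ level set of the possibilistic inferential model contour $\pi_z$. Then $C_\alpha$ is a $100(1-\alpha)\%$ confidence set, i.e., $$\sup_{\theta \in \mathbb{T}} \mathsf{P}_\theta\bigl\{ C_\alpha(Z) \not\ni \theta \bigr\} \leq \alpha.$$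
   Context: In $\mathsf{P}_\theta\{\cdots\}$ the random variable is $Z \sim \mathsf{P}_\theta$; in the definition of $\pi_z(\theta)$ the value $z$ is fixed. It is assumed that $z \mapsto R(z,\theta)$ is measurable for each $\theta$, so that these probabilities are well defined. The ratio $R(z,\theta)$ may be assigned an arbitrary fixed value, e.g. $0$, at points $z$ where $\sup_\vartheta p_\vartheta(z) \in \{0,\infty\}$ (such $z$ form a $\mathsf{P}_\theta$-null set for every $\theta$). *)

theory Defs
  imports "HOL-Probability.Probability"
begin

definition rel_lik :: "real \<Rightarrow> 't set \<Rightarrow> ('t \<Rightarrow> 'z \<Rightarrow> ennreal) \<Rightarrow> 'z \<Rightarrow> 't \<Rightarrow> real"
  where
    \<comment> \<open>\<open>c\<close> is the conventional value of the ratio where it would be \<open>0 / 0\<close> or has an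
      infinite denominator.\<close>
    "rel_lik c T p z \<theta> =
      (let s = (SUP \<eta>\<in>T. p \<eta> z) in
        if s = 0 \<or> s = \<infinity> then c else enn2real (p \<theta> z / s))"

definition im_contour ::
  "real \<Rightarrow> 't set \<Rightarrow> ('t \<Rightarrow> 'z measure) \<Rightarrow> ('t \<Rightarrow> 'z \<Rightarrow> ennreal) \<Rightarrow> 'z \<Rightarrow> 't \<Rightarrow> real"
  where
    "im_contour c T P p z \<theta> =
      measure (P \<theta>) {y \<in> space (P \<theta>). rel_lik c T p y \<theta> \<le> rel_lik c T p z \<theta>}"

definition im_level_set ::
  "real \<Rightarrow> 't set \<Rightarrow> ('t \<Rightarrow> 'z measure) \<Rightarrow> ('t \<Rightarrow> 'z \<Rightarrow> ennreal) \<Rightarrow> real \<Rightarrow> 'z \<Rightarrow> 't set"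
  where
    "im_level_set c T P p \<alpha> z = {\<theta> \<in> T. im_contour c T P p z \<theta> \<ge> \<alpha>}"

text \<open>
  Isabelle assigns measure 0 to non-measurable sets, so a bound on the non-coverage
  probability is meaningful only because the non-coverage event is measurable.
\<close>

lemma noncoverage_measurable:
  assumes "\<theta> \<in> T" "prob_space (P \<theta>)"
    and R: "(\<lambda>z. rel_lik c T p z \<theta>) \<in> borel_measurable (P \<theta>)"
  shows "{z \<in> space (P \<theta>). \<theta> \<notin> im_level_set c T P p \<alpha> z} \<in> sets (P \<theta>)"
proof -
  interpret prob_space "P \<theta>" by fact
  define G where "G t = measure (P \<theta>) {y \<in> space (P \<theta>). rel_lik c T p y \<theta> \<le> t}" for t
  have "mono G"
    unfolding G_def by (intro monoI finite_measure_mono) (use R in auto)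
  then have [measurable]: "G \<in> borel_measurable borel"
    by (rule borel_measurable_mono)
  note R [measurable]
  have "{z \<in> space (P \<theta>). \<theta> \<notin> im_level_set c T P p \<alpha> z} =
      {z \<in> space (P \<theta>). G (rel_lik c T p z \<theta>) < \<alpha>}"
    using \<open>\<theta> \<in> T\<close> by (auto simp: im_level_set_def im_contour_def G_def)
  also have "\<dots> \<in> sets (P \<theta>)" by measurable
  finally show ?thesis .
qed

end

theory Submission
  imports Defs
begin

text \<open>
  Only the law of \<open>R(Z, \<theta>)\<close> under \<open>P \<theta>\<close> matters: applying the cumulative distribution function
  \<open>G\<close> of a real random variable to that variable gives a stochastically superuniform variable.
  The event is that the variable falls in the down-set \<open>{t. G t < \<alpha>}\<close>, whose supremum may or
  may not belong to it. Inner regularity avoids the case distinction: a nonempty compact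
  subset has a maximum \<open>m\<close>, so its mass is at most \<open>G m < \<alpha>\<close>.
\<close>

lemma (in prob_space) prob_integral_transform_le:
  fixes X :: "'a \<Rightarrow> real"
  assumes X [measurable]: "X \<in> borel_measurable M" and "0 \<le> \<alpha>"
  shows "emeasure M {z \<in> space M. \<P>(y in M. X y \<le> X z) < \<alpha>} \<le> ennreal \<alpha>"
proof -
  define G where "G t = \<P>(y in M. X y \<le> t)" for t
  have "mono G"
    unfolding G_def by (intro monoI finite_measure_mono) auto
  then have [measurable]: "G \<in> borel_measurable borel"
    by (rule borel_measurable_mono)
  \<comment> \<open>\<open>M\<close> carries no topology, so the claim is moved to the law of
    \<open>X\<close> on the real line, where compact sets are available.\<close>
  define D where "D = distr M borel X"
  have D_sets: "sets D = sets borel"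
    by (simp add: D_def)
  interpret D: prob_space D
    unfolding D_def by (rule prob_space_distr) simp
  define S where "S = {t. G t < \<alpha>}"
  have S [measurable]: "S \<in> sets borel"
    unfolding S_def by measurable
  have compact_le: "emeasure D K \<le> ennreal \<alpha>" if "K \<subseteq> S" "compact K" for K
  \<comment> \<open>The empty set has no maximum, but its mass is 0.\<close>
  proof (cases "K = {}")
    case False
    with \<open>compact K\<close> obtain m where m: "m \<in> K" "\<And>t. t \<in> K \<Longrightarrow> t \<le> m"
      using compact_attains_sup[of K] by blast
    have "emeasure D K \<le> emeasure D {..m}"
      using m by (intro emeasure_mono) (auto simp: D_def)
    also have "\<dots> = ennreal (G m)"
      unfolding D_def G_def
      by (simp add: emeasure_distr emeasure_eq_measure vimage_def Int_def conj_commute)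
    also have "\<dots> \<le> ennreal \<alpha>"
      using m(1) \<open>K \<subseteq> S\<close> by (intro ennreal_leI) (auto simp: S_def)
    finally show ?thesis .
  qed simp
  have "emeasure M {z \<in> space M. \<P>(y in M. X y \<le> X z) < \<alpha>} = emeasure D S"
    using S by (simp add: D_def emeasure_distr vimage_def Int_def conj_commute S_def G_def)
  \<comment> \<open>A finite Borel measure on a Polish space is inner regular, so the bound on
    compact subsets passes to \<open>S\<close> itself.\<close>
  also have "\<dots> = (SUP K \<in> {K. K \<subseteq> S \<and> compact K}. emeasure D K)"
    by (rule inner_regular) (simp_all add: D_sets S)
  also have "\<dots> \<le> ennreal \<alpha>"
    using compact_le by (auto intro!: SUP_least)
  finally show ?thesis .
qed

theorem corollary1:
  fixes T :: "'t set" and M :: "'z measure" and P :: "'t \<Rightarrow> 'z measure"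
    and p :: "'t \<Rightarrow> 'z \<Rightarrow> ennreal" and c \<alpha> :: real
  assumes "\<And>\<theta>. \<theta> \<in> T \<Longrightarrow> prob_space (P \<theta>)"
    and "\<And>\<theta>. \<theta> \<in> T \<Longrightarrow> p \<theta> \<in> borel_measurable M"
    and "\<And>\<theta>. \<theta> \<in> T \<Longrightarrow> P \<theta> = density M (p \<theta>)"
    and "AE z in M. (SUP \<eta>\<in>T. p \<eta> z) < \<infinity>"
    and "\<And>\<theta>. \<theta> \<in> T \<Longrightarrow> (\<lambda>z. rel_lik c T p z \<theta>) \<in> borel_measurable M"
    and "0 \<le> \<alpha>" and "\<alpha> \<le> 1"
  shows "(SUP \<theta>\<in>T. emeasure (P \<theta>) {z \<in> space (P \<theta>). \<theta> \<notin> im_level_set c T P p \<alpha> z}) \<le> ennreal \<alpha>"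
proof (rule SUP_least)
  fix \<theta> assume \<theta>: "\<theta> \<in> T"
  interpret prob_space "P \<theta>" using assms(1) \<theta> .
  have "(\<lambda>z. rel_lik c T p z \<theta>) \<in> borel_measurable (P \<theta>)"
    using assms(5)[OF \<theta>] by (simp add: assms(3)[OF \<theta>])
  \<comment> \<open>Since \<open>\<theta>\<close> lies in \<open>T\<close>, noncoverage says exactly
    that the contour at \<open>\<theta>\<close> is below \<open>\<alpha>\<close>, which is the event
    just bounded with the relative likelihood at \<open>\<theta>\<close> as
    \<open>X\<close>.\<close>
  from prob_integral_transform_le[OF this \<open>0 \<le> \<alpha>\<close>]
  show "emeasure (P \<theta>) {z \<in> space (P \<theta>). \<theta> \<notin> im_level_set c T P p \<alpha> z} \<le> ennreal \<alpha>"
    using \<theta> by (simp add: im_level_set_def im_contour_def not_le)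
qed

end
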